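(* Let $\alpha>-1$ and let $T$ be a non-zero bounded linear operator on the weighted Bergman space $\mathcal{A}_\alpha^2(\mathbb{D})$. Then $T$ is almost multiplicative if and only if $T$ is a composition operator, i.e. $T=C_\Phi$ for some analytic function $\Phi:\mathbb{D}\to\mathbb{D}$.
   Context: $\mathbb{D}=\{z\in\mathbb{C}:|z|<1\}$. For $\alpha>-1$, $\mathcal{A}_\alpha^2(\mathbb{D})$ is the Hilbert space of analytic functions $f:\mathbb{D}\to\mathbb{C}$ with $\|f\|_\alpha^2=\int_{\mathbb{D}}|f(z)|^2\,dA_\alpha(z)<\infty$, where $dA_\alpha(z)=(\alpha+1)(1-|z|^2)^\alpha\,dA(z)$ and $dA$ is area measure on $\mathbb{D}$ normalized so that $\mathbb{D}$ has measure $1$. For an analytic self-map $\Phi$ of $\mathbb{D}$, the composition operator is $C_\Phi f=f\circ\Phi$. An operator $T$ on $\mathcal{A}_\alpha^2(\mathbb{D})$ is called almost multiplicative if $T(f_1 f_2)=(Tf_1)(Tf_2)$ (pointwise products) whenever $f_1,f_2\in\mathcal{A}_\alpha^2(\mathbb{D})$ satisfy $f_1f_2\in\mathcal{A}_\alpha^2(\mathbb{D})$. *)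

theory Defs
  imports "HOL-Analysis.Analysis"
begin

abbreviation unit_disc :: "complex set" where
  "unit_disc \<equiv> ball 0 1"

text \<open>
  \<^const>\<open>uniform_measure\<close> is area measure on the disc, normalized to total mass 1; it vanishes
  off the disc, so the density factor is only relevant where \<open>1 - (cmod z)\<^sup>2 > 0\<close>.
\<close>
definition bergman_measure :: "real \<Rightarrow> complex measure" where
  "bergman_measure \<alpha> =
     density (uniform_measure lborel unit_disc)
       (\<lambda>z. ennreal ((\<alpha> + 1) * (1 - (cmod z)\<^sup>2) powr \<alpha>))"

text \<open>
  A function on the disc is represented by the function on the whole plane that extends it by 0.
  This makes equality in the space equality of functions on the disc, and the pointwise
  operations below preserve it.
\<close>
definition bergman_space :: "real \<Rightarrow> (complex \<Rightarrow> complex) set" where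
  "bergman_space \<alpha> =
     {f. f holomorphic_on unit_disc \<and> (\<forall>z. z \<notin> unit_disc \<longrightarrow> f z = 0) \<and>
         integrable (bergman_measure \<alpha>) (\<lambda>z. (cmod (f z))\<^sup>2)}"

definition bergman_norm :: "real \<Rightarrow> (complex \<Rightarrow> complex) \<Rightarrow> real" where
  "bergman_norm \<alpha> f = sqrt (\<integral>z. (cmod (f z))\<^sup>2 \<partial>bergman_measure \<alpha>)"

text \<open>Only the values of an operator on the space itself matter.\<close>
definition bounded_linear_operator ::
    "real \<Rightarrow> ((complex \<Rightarrow> complex) \<Rightarrow> (complex \<Rightarrow> complex)) \<Rightarrow> bool" where
  "bounded_linear_operator \<alpha> T \<longleftrightarrow>
     (\<forall>f\<in>bergman_space \<alpha>. T f \<in> bergman_space \<alpha>) \<and>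
     (\<forall>f\<in>bergman_space \<alpha>. \<forall>g\<in>bergman_space \<alpha>. T (\<lambda>z. f z + g z) = (\<lambda>z. T f z + T g z)) \<and>
     (\<forall>c. \<forall>f\<in>bergman_space \<alpha>. T (\<lambda>z. c * f z) = (\<lambda>z. c * T f z)) \<and>
     (\<exists>C. \<forall>f\<in>bergman_space \<alpha>. bergman_norm \<alpha> (T f) \<le> C * bergman_norm \<alpha> f)"

definition almost_multiplicative ::
    "real \<Rightarrow> ((complex \<Rightarrow> complex) \<Rightarrow> (complex \<Rightarrow> complex)) \<Rightarrow> bool" where
  "almost_multiplicative \<alpha> T \<longleftrightarrow>
     (\<forall>f\<in>bergman_space \<alpha>. \<forall>g\<in>bergman_space \<alpha>.
        (\<lambda>z. f z * g z) \<in> bergman_space \<alpha> \<longrightarrow>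
        T (\<lambda>z. f z * g z) = (\<lambda>z. T f z * T g z))"

definition composition_operator ::
    "(complex \<Rightarrow> complex) \<Rightarrow> (complex \<Rightarrow> complex) \<Rightarrow> (complex \<Rightarrow> complex)" where
  "composition_operator \<Phi> f = (\<lambda>z. if z \<in> unit_disc then f (\<Phi> z) else 0)"

end

theory Submission
  imports Defs "HOL-Complex_Analysis.Cauchy_Integral_Formula"
    "HOL-Probability.Distribution_Functions"
begin

text \<open>
  Multiplicativity makes \<open>T 1\<close> a nonzero idempotent analytic function, so \<open>T 1 = 1\<close>, and \<open>\<Phi>\<close>
  has to be the image of the identity. For \<open>f\<close> in the space and \<open>w = \<Phi> z\<close> in the disc,
  \<open>f - f w = (z - w) h\<close> with \<open>h\<close> again in the space, so \<open>T f - f w\<close> vanishes at \<open>z\<close>, without any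
  appeal to the density of polynomials. That \<open>\<Phi>\<close> maps into the disc is also algebraic:
  for \<open>\<lambda>\<close> off the disc, high roots of \<open>1 - z / \<lambda>\<close> have their inverses in the space.
\<close>

section \<open>The Bergman measure\<close>

lemma measure_uniform_disc_ball:
  assumes "0 \<le> r" "r \<le> 1"
  shows "measure (uniform_measure lborel unit_disc) (ball 0 r) = r\<^sup>2"
proof -
  have "unit_disc \<inter> ball 0 r = ball (0::complex) r"
    using assms by auto
  moreover have "measure lborel (ball (0::complex) r) = pi * r\<^sup>2"
    using content_ball[of r "0::complex"] assms by (simp add: unit_ball_vol_2)
  moreover have "measure lborel (ball (0::complex) 1) = pi"
    using content_ball[of 1 "0::complex"] by (simp add: unit_ball_vol_2)
  moreover have "emeasure lborel (ball (0::complex) 1) = ennreal pi"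
    using emeasure_ball[of 1 "0::complex"] by (simp add: unit_ball_vol_2)
  ultimately show ?thesis
    by (subst measure_uniform_measure) auto
qed

lemma prob_space_uniform_disc: "prob_space (uniform_measure lborel unit_disc)"
  using emeasure_ball[of 1 "0::complex"]
  by (intro prob_space_uniform_measure) (auto simp: unit_ball_vol_2)

text \<open>The disc of radius r has normalized area r^2, so the squared modulus of a random point
  is uniform on [0,1], and so is its reflection. This replaces polar coordinates in the weight
  integrals.\<close>

lemma distr_uniform_disc:
  "distr (uniform_measure lborel unit_disc) borel (\<lambda>z. 1 - (cmod z)\<^sup>2) =
   uniform_measure lborel {0..1}"
proof (rule cdf_unique)
  interpret P: prob_space "uniform_measure lborel unit_disc"
    by (rule prob_space_uniform_disc)
  let ?u = "\<lambda>z::complex. 1 - (cmod z)\<^sup>2"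
  have meas: "?u \<in> borel_measurable (uniform_measure lborel unit_disc)"
    by simp
  show "real_distribution (distr (uniform_measure lborel unit_disc) borel ?u)"
    using meas by (rule P.real_distribution_distr)
  have U: "prob_space (uniform_measure lborel {0..1::real})"
    by (intro prob_space_uniform_measure) auto
  then show "real_distribution (uniform_measure lborel {0..1::real})"
    by (simp add: real_distribution_def real_distribution_axioms_def)
  show "cdf (distr (uniform_measure lborel unit_disc) borel ?u) = cdf (uniform_measure lborel {0..1})"
  proof
    fix x :: real
    have L: "cdf (distr (uniform_measure lborel unit_disc) borel ?u) x
        = P.prob {z. ?u z \<le> x}"
      unfolding cdf_def by (subst measure_distr) (auto simp: vimage_def)
    have R: "cdf (uniform_measure lborel {0..1}) x = measure lborel ({0..1} \<inter> {..x})"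
      unfolding cdf_def by (subst measure_uniform_measure) auto
    consider "x < 0" | "0 \<le> x" "x \<le> 1" | "1 < x" by linarith
    then show "cdf (distr (uniform_measure lborel unit_disc) borel ?u) x
        = cdf (uniform_measure lborel {0..1}) x"
    proof cases
      case 1
      have "unit_disc \<inter> {z. ?u z \<le> x} = {}"
      proof -
        have "(cmod z)\<^sup>2 < 1" if "cmod z < 1" for z :: complex
          using that by (simp add: abs_square_less_1)
        with 1 show ?thesis by fastforce
      qed
      then have "P.prob {z. ?u z \<le> x} = 0"
        by (subst measure_uniform_measure) (auto simp: emeasure_ball unit_ball_vol_2)
      moreover have "{0..1} \<inter> {..x} = {}" using 1 by auto
      ultimately show ?thesis by (simp add: L R)
    next
      case 2
      \<comment> \<open>The condition says that \<open>cmod z\<close> is at least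
        \<open>sqrt (1 - x)\<close>, so the event is the complement of a ball of known
        measure.\<close>
      have eq: "{z. ?u z \<le> x} = space (uniform_measure lborel unit_disc) - ball 0 (sqrt (1 - x))"
      proof -
        have "(cmod z < sqrt (1 - x)) = ((cmod z)\<^sup>2 < 1 - x)" for z
          using 2 by (metis abs_norm_cancel real_sqrt_abs real_sqrt_less_iff)
        then show ?thesis by (auto simp: not_less)
      qed
      have "P.prob {z. ?u z \<le> x} = 1 - (sqrt (1 - x))\<^sup>2"
        unfolding eq using 2
        by (subst P.prob_compl) (auto simp: measure_uniform_disc_ball)
      moreover have "{0..1} \<inter> {..x} = {0..x}" using 2 by auto
      ultimately show ?thesis using 2 by (simp add: L R)
    next
      case 3
      have "{z. ?u z \<le> x} = space (uniform_measure lborel unit_disc)"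
        using 3 by (auto intro: order_trans[of _ 1])
      moreover have "{0..1} \<inter> {..x} = {0..1}" using 3 by auto
      ultimately show ?thesis using P.prob_space by (simp add: L R)
    qed
  qed
qed

text \<open>Transport along \<open>1 - (cmod z)\<^sup>2\<close> turns the integral into that of
  \<open>x powr \<beta>\<close> over [0,1], which is 1/(\<beta>+1).\<close>

lemma nn_integral_bergman_weight_finite:
  assumes "\<beta> > -1"
  shows "(\<integral>\<^sup>+z. ennreal ((1 - (cmod z)\<^sup>2) powr \<beta>) \<partial>uniform_measure lborel unit_disc) < \<infinity>"
proof -
  have "(\<integral>\<^sup>+z. ennreal ((1 - (cmod z)\<^sup>2) powr \<beta>) \<partial>uniform_measure lborel unit_disc)
      = (\<integral>\<^sup>+x. ennreal (x powr \<beta>) \<partial>distr (uniform_measure lborel unit_disc) borel (\<lambda>z. 1 - (cmod z)\<^sup>2))"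
    by (subst nn_integral_distr) auto
  also have "\<dots> = (\<integral>\<^sup>+x. ennreal (x powr \<beta>) * indicator {0..1} x \<partial>lborel)"
    unfolding distr_uniform_disc by (subst nn_integral_uniform_measure) (auto simp: divide_ennreal_def)
  also have "\<dots> = ennreal (1 powr (\<beta> + 1) / (\<beta> + 1))"
    using has_integral_powr_from_0[OF assms, of 1]
    by (intro nn_integral_has_integral_lebesgue') auto
  finally show ?thesis by simp
qed

lemma integrable_bergman_weight_powr:
  assumes "\<alpha> > -1" "\<alpha> + s > -1"
  shows "integrable (bergman_measure \<alpha>) (\<lambda>z. (1 - (cmod z)\<^sup>2) powr s)"
proof -
  let ?P = "uniform_measure lborel unit_disc"
  have "integrable ?P (\<lambda>z. (\<alpha> + 1) * (1 - (cmod z)\<^sup>2) powr (\<alpha> + s))"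
    using nn_integral_bergman_weight_finite[OF assms(2)]
    by (intro integrable_mult_right integrableI_nonneg) auto
  then show ?thesis
    unfolding bergman_measure_def using assms
    by (subst integrable_density) (auto simp: powr_add mult_ac)
qed

text \<open>The exponent s = 0 in the previous lemma does not literally give a constant, since
  \<open>0 powr 0 = 0\<close> on the unit circle; the density argument is therefore
  repeated.\<close>

lemma integrable_bergman_measure_const:
  assumes "\<alpha> > -1"
  shows "integrable (bergman_measure \<alpha>) (\<lambda>z. c :: real)"
proof -
  let ?P = "uniform_measure lborel unit_disc"
  have "integrable ?P (\<lambda>z. (\<alpha> + 1) * (1 - (cmod z)\<^sup>2) powr \<alpha> * c)"
    using nn_integral_bergman_weight_finite[OF assms]
    by (intro integrable_mult_left integrable_mult_right integrableI_nonneg) auto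
  then show ?thesis
    unfolding bergman_measure_def using assms
    by (subst integrable_density) (auto simp: mult_ac)
qed

section \<open>Membership in the Bergman space\<close>

text \<open>Turns a formula that matters only on the disc into the zero-extended representative that
  \<open>bergman_space\<close> requires.\<close>

definition disc_ext :: "(complex \<Rightarrow> complex) \<Rightarrow> complex \<Rightarrow> complex" where
  "disc_ext g = (\<lambda>z. if z \<in> unit_disc then g z else 0)"

lemma disc_ext_in [simp]: "z \<in> unit_disc \<Longrightarrow> disc_ext g z = g z"
  by (simp add: disc_ext_def)

lemma disc_ext_mult: "(\<lambda>z. disc_ext f z * disc_ext g z) = disc_ext (\<lambda>z. f z * g z)"
  by (auto simp: disc_ext_def)

lemma sets_bergman_measure [measurable_cong]: "sets (bergman_measure \<alpha>) = sets borel"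
  by (simp add: bergman_measure_def)

lemma disc_ext_in_bergman:
  assumes hol: "g holomorphic_on unit_disc"
    and int: "integrable (bergman_measure \<alpha>) w"
    and le: "\<And>z. z \<in> unit_disc \<Longrightarrow> (cmod (g z))\<^sup>2 \<le> w z"
    and nonneg: "\<And>z. w z \<ge> 0"
  shows "disc_ext g \<in> bergman_space \<alpha>"
proof -
  \<comment> \<open>Continuity on the open disc makes the zero extension Borel on the whole plane,
    whatever values g takes outside.\<close>
  have "(\<lambda>z. indicator unit_disc z *\<^sub>R g z) \<in> borel_measurable borel"
    using hol by (intro borel_measurable_continuous_on_indicator holomorphic_on_imp_continuous_on) auto
  also have "(\<lambda>z. indicator unit_disc z *\<^sub>R g z) = disc_ext g"
    by (auto simp: disc_ext_def indicator_def)
  finally have [measurable]: "disc_ext g \<in> borel_measurable borel" .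
  have "integrable (bergman_measure \<alpha>) (\<lambda>z. (cmod (disc_ext g z))\<^sup>2)"
  proof (rule Bochner_Integration.integrable_bound[OF int])
    show "(\<lambda>z. (cmod (disc_ext g z))\<^sup>2) \<in> borel_measurable (bergman_measure \<alpha>)"
      by measurable
  qed (use le nonneg in \<open>auto simp: disc_ext_def\<close>)
  moreover have "disc_ext g holomorphic_on unit_disc"
    using hol by (rule holomorphic_transform) simp
  ultimately show ?thesis
    by (auto simp: bergman_space_def disc_ext_def)
qed

text \<open>Square integrability passes from f to g by (a+b)^2 \<le> 2a^2 + 2b^2. The constant A
  absorbs bounded terms, so f itself may be unbounded.\<close>

lemma disc_ext_in_bergman_compare:
  assumes "\<alpha> > -1" "g holomorphic_on unit_disc" "f \<in> bergman_space \<alpha>"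
    and le: "\<And>z. z \<in> unit_disc \<Longrightarrow> cmod (g z) \<le> A + K * cmod (f z)"
  shows "disc_ext g \<in> bergman_space \<alpha>"
proof (rule disc_ext_in_bergman)
  show "g holomorphic_on unit_disc" by fact
  show "integrable (bergman_measure \<alpha>) (\<lambda>z. 2 * A\<^sup>2 + 2 * K\<^sup>2 * (cmod (f z))\<^sup>2)"
    using assms integrable_bergman_measure_const[OF assms(1)]
    by (intro Bochner_Integration.integrable_add integrable_mult_right)
       (auto simp: bergman_space_def)
  show "(cmod (g z))\<^sup>2 \<le> 2 * A\<^sup>2 + 2 * K\<^sup>2 * (cmod (f z))\<^sup>2" if "z \<in> unit_disc" for z
  proof -
    have "(cmod (g z))\<^sup>2 \<le> (A + K * cmod (f z))\<^sup>2"
      using le[OF that] by (intro power_mono) auto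
    also have "\<dots> \<le> 2 * A\<^sup>2 + 2 * K\<^sup>2 * (cmod (f z))\<^sup>2"
      using sum_squares_bound[of A "K * cmod (f z)"] by (simp add: power2_sum power_mult_distrib)
    finally show ?thesis .
  qed
qed auto

text \<open>Squaring the bound doubles the exponent, and the weight absorbs a singularity of order
  2s at the boundary as long as \<alpha> - 2s > -1.\<close>

lemma disc_ext_in_bergman_powr:
  assumes "\<alpha> > -1" "\<alpha> - 2 * s > -1" "g holomorphic_on unit_disc"
    and le: "\<And>z. z \<in> unit_disc \<Longrightarrow> cmod (g z) \<le> C * (1 - (cmod z)\<^sup>2) powr (- s)"
  shows "disc_ext g \<in> bergman_space \<alpha>"
proof (rule disc_ext_in_bergman)
  show "g holomorphic_on unit_disc" by fact
  show "integrable (bergman_measure \<alpha>) (\<lambda>z. C\<^sup>2 * (1 - (cmod z)\<^sup>2) powr (- (2 * s)))"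
    using assms by (intro integrable_mult_right integrable_bergman_weight_powr) auto
  show "(cmod (g z))\<^sup>2 \<le> C\<^sup>2 * (1 - (cmod z)\<^sup>2) powr (- (2 * s))" if "z \<in> unit_disc" for z
  proof -
    have "(cmod (g z))\<^sup>2 \<le> (C * (1 - (cmod z)\<^sup>2) powr (- s))\<^sup>2"
      using le[OF that] by (intro power_mono) auto
    also have "\<dots> = C\<^sup>2 * (1 - (cmod z)\<^sup>2) powr (- (2 * s))"
      by (simp add: power_mult_distrib power2_eq_square flip: powr_add)
    finally show ?thesis .
  qed
qed auto

lemma disc_ext_in_bergman_bounded:
  assumes "\<alpha> > -1" "g holomorphic_on unit_disc"
    and "\<And>z. z \<in> unit_disc \<Longrightarrow> cmod (g z) \<le> C"
  shows "disc_ext g \<in> bergman_space \<alpha>"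
proof (rule disc_ext_in_bergman)
  show "integrable (bergman_measure \<alpha>) (\<lambda>z. C\<^sup>2)"
    using assms by (intro integrable_bergman_measure_const)
qed (use assms in \<open>auto intro: power_mono\<close>)

text \<open>The singularity at w is removable. Near w the quotient is bounded by compactness; at
  distance more than d from w the division costs at most a factor 1/d.\<close>

lemma bergman_difference_quotient:
  assumes "\<alpha> > -1" "f \<in> bergman_space \<alpha>" "w \<in> unit_disc"
  shows "disc_ext (\<lambda>z. if z = w then deriv f w else (f z - f w) / (z - w)) \<in> bergman_space \<alpha>"
    (is "disc_ext ?h \<in> _")
proof -
  have hol: "?h holomorphic_on unit_disc"
    using assms by (intro pole_lemma_open) (auto simp: bergman_space_def)
  obtain d where d: "d > 0" "cball w d \<subseteq> unit_disc"
    using assms(3) open_contains_cball open_ball by blast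
  have "compact (?h ` cball w d)"
    using hol d by (intro compact_continuous_image)
      (auto intro: holomorphic_on_imp_continuous_on continuous_on_subset)
  then obtain B where B: "\<And>z. z \<in> cball w d \<Longrightarrow> cmod (?h z) \<le> B"
    by (metis (no_types, lifting) bounded_iff compact_imp_bounded imageI)
  have B0: "B \<ge> 0"
    using B[of w] d by (meson centre_in_cball less_imp_le norm_ge_zero order_trans)
  show ?thesis
  proof (rule disc_ext_in_bergman_compare[OF assms(1) hol assms(2)])
    fix z :: complex
    \<comment> \<open>The sum of the bounds inside and outside \<open>cball w d\<close> serves both
      cases, all terms being nonnegative.\<close>
    show "cmod (?h z) \<le> (B + cmod (f w) / d) + (1 / d) * cmod (f z)"
    proof (cases "z \<in> cball w d")
      case True
      have "0 \<le> cmod (f w) / d" "0 \<le> (1 / d) * cmod (f z)"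
        using d by auto
      with B[OF True] show ?thesis by linarith
    next
      case False
      then have far: "d < cmod (z - w)" by (simp add: dist_norm norm_minus_commute)
      then have "z \<noteq> w" using d by auto
      then have "cmod (?h z) = cmod (f z - f w) / cmod (z - w)"
        by (simp add: norm_divide)
      also have "\<dots> \<le> (cmod (f z) + cmod (f w)) / d"
        using far d by (intro frac_le norm_triangle_ineq4) auto
      finally show ?thesis using B0 by (simp add: add_divide_distrib)
    qed
  qed
qed

section \<open>Almost multiplicative operators\<close>

locale almost_multiplicative_operator =
  fixes \<alpha> :: real and T :: "(complex \<Rightarrow> complex) \<Rightarrow> (complex \<Rightarrow> complex)"
  assumes alpha: "\<alpha> > -1"
    and bounded_linear: "bounded_linear_operator \<alpha> T"
    and nonzero: "\<exists>f\<in>bergman_space \<alpha>. T f \<noteq> (\<lambda>z. 0)"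
    and mult: "almost_multiplicative \<alpha> T"
begin

definition symbol :: "complex \<Rightarrow> complex" where
  "symbol = T (disc_ext (\<lambda>z. z))"

lemma T_in: "f \<in> bergman_space \<alpha> \<Longrightarrow> T f \<in> bergman_space \<alpha>"
  using bounded_linear by (auto simp: bounded_linear_operator_def)

lemma T_add:
  "f \<in> bergman_space \<alpha> \<Longrightarrow> g \<in> bergman_space \<alpha> \<Longrightarrow> T (\<lambda>z. f z + g z) z = T f z + T g z"
  using bounded_linear by (auto simp: bounded_linear_operator_def)

lemma T_scale: "f \<in> bergman_space \<alpha> \<Longrightarrow> T (\<lambda>z. c * f z) z = c * T f z"
  using bounded_linear by (auto simp: bounded_linear_operator_def)

lemma T_mult:
  assumes "f \<in> bergman_space \<alpha>" "g \<in> bergman_space \<alpha>" "(\<lambda>z. f z * g z) \<in> bergman_space \<alpha>"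
  shows "T (\<lambda>z. f z * g z) z = T f z * T g z"
proof -
  have "T (\<lambda>z. f z * g z) = (\<lambda>z. T f z * T g z)"
    using mult assms by (simp add: almost_multiplicative_def)
  then show ?thesis by simp
qed

lemma T_holomorphic: "f \<in> bergman_space \<alpha> \<Longrightarrow> T f holomorphic_on unit_disc"
  using T_in by (auto simp: bergman_space_def)

lemma const_in: "disc_ext (\<lambda>z. c) \<in> bergman_space \<alpha>"
  using alpha by (intro disc_ext_in_bergman_bounded[where C = "cmod c"]) auto

lemma id_in: "disc_ext (\<lambda>z. z) \<in> bergman_space \<alpha>"
  using alpha by (intro disc_ext_in_bergman_bounded[where C = 1]) auto

section \<open>Values on constants, affine functions and powers\<close>

text \<open>The function 1 is a unit for products, so its image is idempotent and takes only the
  values 0 and 1. By continuity on the connected disc it is constant, and it is 1 at any point where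
  some \<open>T f\<close> does not vanish.\<close>

lemma T_one:
  assumes z: "z \<in> unit_disc"
  shows "T (disc_ext (\<lambda>z. 1)) z = 1"
proof -
  let ?e = "disc_ext (\<lambda>z. 1)"
  have unit: "T f z = T f z * T ?e z" if "f \<in> bergman_space \<alpha>" for f z
  proof -
    have "(\<lambda>z. f z * ?e z) = f"
      using that by (auto simp: bergman_space_def disc_ext_def)
    then show ?thesis
      using T_mult[of f ?e z] that const_in by simp
  qed
  obtain f z1 where f: "f \<in> bergman_space \<alpha>" "T f z1 \<noteq> 0"
    using nonzero by (auto simp: fun_eq_iff)
  then have one: "T ?e z1 = 1" using unit[of f z1] by simp
  \<comment> \<open>The point \<open>z1\<close> comes from an inequality of functions on the whole
    plane; the zero extension forces it into the disc.\<close>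
  have "T f z = 0" if "z \<notin> unit_disc" for z
    using T_in[OF f(1)] that by (auto simp: bergman_space_def)
  then have z1: "z1 \<in> unit_disc" using f(2) by blast
  have conn: "connected (T ?e ` unit_disc)"
    using T_holomorphic[OF const_in]
    by (intro connected_continuous_image holomorphic_on_imp_continuous_on) auto
  have "T ?e ` unit_disc \<subseteq> {0, 1}"
    using unit[OF const_in] by fastforce
  then have "finite (T ?e ` unit_disc)"
    by (rule finite_subset) simp
  then have "T ?e ` unit_disc = {} \<or> (\<exists>a. T ?e ` unit_disc = {a})"
    using connected_finite_iff_sing[OF conn] by simp
  moreover have "T ?e z \<in> T ?e ` unit_disc" "T ?e z1 \<in> T ?e ` unit_disc"
    using z z1 by blast+
  ultimately have "T ?e z = T ?e z1" by (metis emptyE singletonD)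
  then show ?thesis using one by simp
qed

lemma T_const:
  assumes "z \<in> unit_disc"
  shows "T (disc_ext (\<lambda>z. c)) z = c"
proof -
  have "disc_ext (\<lambda>z. c) = (\<lambda>z. c * disc_ext (\<lambda>z. 1) z)"
    by (auto simp: disc_ext_def)
  then show ?thesis using T_scale[OF const_in, of c 1 z] T_one[OF assms] by simp
qed

text \<open>Covers the two affine functions used below: \<open>1 - z / l\<close>, which shows that
  the symbol stays in the disc, and the factor \<open>z - w\<close> of the final division.\<close>

lemma T_affine:
  assumes "z \<in> unit_disc"
  shows "T (disc_ext (\<lambda>z. c * z + b)) z = c * symbol z + b"
proof -
  have scaled: "(\<lambda>z. c * disc_ext (\<lambda>z. z) z) = disc_ext (\<lambda>z. c * z)"
    by (auto simp: disc_ext_def)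
  have in': "disc_ext (\<lambda>z. c * z) \<in> bergman_space \<alpha>"
    using alpha
    by (intro disc_ext_in_bergman_bounded[where C = "cmod c"])
       (auto intro!: holomorphic_intros simp: norm_mult mult_left_le)
  have "disc_ext (\<lambda>z. c * z + b) = (\<lambda>z. disc_ext (\<lambda>z. c * z) z + disc_ext (\<lambda>z. b) z)"
    by (auto simp: disc_ext_def)
  then have "T (disc_ext (\<lambda>z. c * z + b)) z = T (disc_ext (\<lambda>z. c * z)) z + b"
    using T_add[OF in' const_in] T_const[OF assms] by simp
  also have "T (disc_ext (\<lambda>z. c * z)) z = c * symbol z"
    using T_scale[OF id_in, of c z] by (simp add: scaled symbol_def)
  finally show ?thesis .
qed

text \<open>Boundedness of g keeps every power in the space, so multiplicativity applies at each
  step of the induction.\<close>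

lemma T_power:
  assumes "g holomorphic_on unit_disc" "\<And>z. z \<in> unit_disc \<Longrightarrow> cmod (g z) \<le> C"
    and z: "z \<in> unit_disc"
  shows "T (disc_ext (\<lambda>z. g z ^ n)) z = T (disc_ext g) z ^ n"
proof (induction n)
  case 0
  then show ?case using T_one[OF z] by simp
next
  case (Suc n)
  have pow: "disc_ext (\<lambda>z. g z ^ k) \<in> bergman_space \<alpha>" for k
    using assms alpha
    by (intro disc_ext_in_bergman_bounded[where C = "C ^ k"])
       (auto intro!: holomorphic_intros power_mono simp: norm_power)
  then have "T (disc_ext (\<lambda>z. g z * g z ^ n)) z
      = T (disc_ext g) z * T (disc_ext (\<lambda>z. g z ^ n)) z"
    using T_mult[of "disc_ext g" "disc_ext (\<lambda>z. g z ^ n)" z] pow[of 1] pow[of n] pow[of "Suc n"]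
    by (simp add: disc_ext_mult)
  then show ?case using Suc by simp
qed

text \<open>
  If \<open>\<lambda> = symbol z0\<close> lay off the disc, then \<open>T\<close> would send \<open>1 - z / \<lambda>\<close>, and hence its \<open>m\<close>-th root,
  to a function vanishing at \<open>z0\<close>; but for large \<open>m\<close> this root is invertible in the space.
\<close>
lemma symbol_in_disc:
  assumes z0: "z0 \<in> unit_disc"
  shows "symbol z0 \<in> unit_disc"
proof (rule ccontr)
  define l where "l = symbol z0"
  assume "symbol z0 \<notin> unit_disc"
  then have l: "cmod l \<ge> 1" by (simp add: l_def)
  then have l0: "l \<noteq> 0" by auto
  \<comment> \<open>This choice gives 2/m < \<alpha> + 1, so the inverse of the m-th root, of order
    1/m at the boundary, is square integrable; the 0 in \<open>max\<close> ensures m > 0.\<close>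
  obtain m :: nat where "max 0 (2 / (\<alpha> + 1)) < real m"
    using reals_Archimedean2 by blast
  then have m: "m > 0" "2 / (\<alpha> + 1) < real m" by auto
  define s where "s = 1 / real m"
  have s: "s > 0" "\<alpha> - 2 * s > -1"
    using m alpha by (auto simp: s_def field_simps)
  define q where "q = (\<lambda>z. (-1 / l) * z + 1)"
  have q_le: "cmod (z / l) \<le> cmod z" for z
    using l by (simp add: norm_divide divide_le_eq mult_left_le mult_le_cancel_left1)
  have q_eq: "q z = 1 - z / l" for z by (simp add: q_def)
  have q_lower: "1 - cmod z \<le> cmod (q z)" for z
    using q_le[of z] norm_triangle_ineq2[of 1 "z / l"] by (simp add: q_eq)
  have q_upper: "cmod (q z) \<le> 2" if "z \<in> unit_disc" for z
    using that q_le[of z] norm_triangle_ineq4[of 1 "z / l"] by (simp add: q_eq)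
  \<comment> \<open>As \<open>cmod l\<close> is at least 1, q maps the disc into the right
    half-plane, off the branch cut, so the principal powers of q are holomorphic.\<close>
  have q_Re: "Re (q z) > 0" if "z \<in> unit_disc" for z
    using that q_le[of z] complex_Re_le_cmod[of "z / l"] by (simp add: q_eq)
  have q_cut: "q z \<notin> \<real>\<^sub>\<le>\<^sub>0" if "z \<in> unit_disc" for z
    using q_Re[OF that] complex_nonpos_Reals_iff by force
  have q_0: "q z \<noteq> 0" if "z \<in> unit_disc" for z
    using q_Re[OF that] by auto
  have q_hol: "q holomorphic_on unit_disc"
    unfolding q_def by (intro holomorphic_intros)
  define g where "g = (\<lambda>z. q z powr of_real s)"
  define h where "h = (\<lambda>z. q z powr of_real (- s))"
  have hol: "g holomorphic_on unit_disc" "h holomorphic_on unit_disc"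
    unfolding g_def h_def using q_cut q_hol by (auto intro!: holomorphic_intros)
  have g_bd: "cmod (g z) \<le> 2 powr s" if "z \<in> unit_disc" for z
    unfolding g_def using s q_upper[OF that]
    by (subst norm_powr_real_powr') (auto intro!: powr_mono2)
  have g_in: "disc_ext g \<in> bergman_space \<alpha>"
    using alpha hol g_bd by (intro disc_ext_in_bergman_bounded)
  have h_in: "disc_ext h \<in> bergman_space \<alpha>"
  proof (rule disc_ext_in_bergman_powr[OF alpha s(2) hol(2)])
    fix z :: complex assume z: "z \<in> unit_disc"
    \<comment> \<open>Since (1 + \<open>cmod z\<close>)/2 \<le> 1, the lower bound
      \<open>1 - cmod z\<close> for \<open>cmod (q z)\<close> is traded for half the weight base;
      the negative exponent then reverses the inequality.\<close>
    have "(1 - (cmod z)\<^sup>2) / 2 = (1 - cmod z) * ((1 + cmod z) / 2)"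
      by (simp add: power2_eq_square algebra_simps)
    also have "\<dots> \<le> (1 - cmod z) * 1"
      using z by (intro mult_left_mono) auto
    finally have le: "(1 - (cmod z)\<^sup>2) / 2 \<le> cmod (q z)"
      using q_lower[of z] by simp
    have pos: "1 - (cmod z)\<^sup>2 > 0"
      using z by (simp add: abs_square_less_1)
    have "cmod (h z) = cmod (q z) powr (- s)"
      unfolding h_def by (subst norm_powr_real_powr') auto
    also have "\<dots> \<le> ((1 - (cmod z)\<^sup>2) / 2) powr (- s)"
      using le pos s by (intro powr_mono2') auto
    also have "\<dots> = 2 powr s * (1 - (cmod z)\<^sup>2) powr (- s)"
      using pos by (subst powr_divide) (auto simp: powr_minus field_simps)
    finally show "cmod (h z) \<le> 2 powr s * (1 - (cmod z)\<^sup>2) powr (- s)" .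
  qed
  have "disc_ext (\<lambda>z. g z ^ m) = disc_ext q"
  proof
    fix z
    show "disc_ext (\<lambda>z. g z ^ m) z = disc_ext q z"
    proof (cases "z \<in> unit_disc")
      case True
      have "g z ^ m = q z powr (of_nat m * of_real s)"
        unfolding g_def using q_0[OF True] by (simp add: powr_def exp_of_nat_mult mult_ac)
      also have "of_nat m * of_real s = (1::complex)"
        using m by (simp add: s_def)
      finally show ?thesis using True q_0[OF True] by simp
    qed (simp add: disc_ext_def)
  qed
  then have "T (disc_ext g) z0 ^ m = T (disc_ext q) z0"
    using T_power[OF hol(1) g_bd z0, of m] by simp
  also have "\<dots> = 0"
    unfolding q_def by (subst T_affine[OF z0]) (use l0 in \<open>simp add: l_def\<close>)
  finally have zero: "T (disc_ext g) z0 = 0" by simp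
  \<comment> \<open>The contradiction: T preserves the identity g h = 1, but the image of g vanishes
    at \<open>z0\<close>.\<close>
  have "(\<lambda>z. disc_ext g z * disc_ext h z) = disc_ext (\<lambda>z. 1)"
    unfolding disc_ext_mult using q_0
    by (auto simp: disc_ext_def g_def h_def fun_eq_iff simp flip: powr_add)
  then have "T (disc_ext g) z0 * T (disc_ext h) z0 = 1"
    using T_mult[OF g_in h_in, of z0] const_in[of 1] T_one[OF z0] by simp
  with zero show False by simp
qed

text \<open>Apply \<open>T\<close> to \<open>f - f w = (z - w) h\<close> with \<open>w = symbol z\<close>: the image of the factor \<open>z - w\<close> vanishes at \<open>z\<close>.\<close>
lemma T_eq_symbol:
  assumes f: "f \<in> bergman_space \<alpha>" and z: "z \<in> unit_disc"
  shows "T f z = f (symbol z)"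
proof -
  define w where "w = symbol z"
  have w: "w \<in> unit_disc" using symbol_in_disc[OF z] by (simp add: w_def)
  define h where "h = disc_ext (\<lambda>u. if u = w then deriv f w else (f u - f w) / (u - w))"
  \<comment> \<open>The form \<open>1 * u + (- w)\<close> matches \<open>T_affine\<close>
    syntactically.\<close>
  define p where "p = disc_ext (\<lambda>u. 1 * u + (- w))"
  have h_in: "h \<in> bergman_space \<alpha>"
    unfolding h_def using alpha f w by (rule bergman_difference_quotient)
  have p_in: "p \<in> bergman_space \<alpha>"
    unfolding p_def
    by (rule disc_ext_in_bergman_compare[OF alpha _ id_in, where A = "cmod w" and K = 1])
       (auto intro!: holomorphic_intros simp: norm_triangle_ineq4 add.commute)
  \<comment> \<open>At u = w both sides are 0, whatever value h has there; the derivative is chosen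
    only to make h holomorphic.\<close>
  have ph: "(\<lambda>u. p u * h u) = disc_ext (\<lambda>u. f u - f w)"
    by (auto simp: p_def h_def disc_ext_def)
  have ph_in: "(\<lambda>u. p u * h u) \<in> bergman_space \<alpha>"
    unfolding ph
  proof (rule disc_ext_in_bergman_compare[OF alpha _ f])
    show "(\<lambda>u. f u - f w) holomorphic_on unit_disc"
      using f by (auto intro!: holomorphic_intros simp: bergman_space_def)
    show "cmod (f u - f w) \<le> cmod (f w) + 1 * cmod (f u)" for u
      using norm_triangle_ineq4[of "f u" "f w"] by simp
  qed
  have "(\<lambda>u. p u * h u + disc_ext (\<lambda>u. f w) u) = f"
    using f fun_cong[OF ph] by (auto simp: fun_eq_iff disc_ext_def bergman_space_def)
  then have "T f z = T (\<lambda>u. p u * h u) z + f w"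
    using T_add[OF ph_in const_in, of "f w" z] T_const[OF z] by simp
  also have "T (\<lambda>u. p u * h u) z = T p z * T h z"
    by (rule T_mult[OF p_in h_in ph_in])
  also have "T p z = 0"
    unfolding p_def T_affine[OF z] by (simp add: w_def)
  finally show ?thesis by (simp add: w_def)
qed

lemma is_composition_operator:
  "\<exists>\<Phi>. \<Phi> holomorphic_on unit_disc \<and> \<Phi> ` unit_disc \<subseteq> unit_disc \<and>
       (\<forall>f\<in>bergman_space \<alpha>. T f = composition_operator \<Phi> f)"
proof (intro exI conjI ballI)
  show "symbol holomorphic_on unit_disc"
    unfolding symbol_def by (rule T_holomorphic[OF id_in])
  show "symbol ` unit_disc \<subseteq> unit_disc"
    using symbol_in_disc by blast
  fix f assume f: "f \<in> bergman_space \<alpha>"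
  show "T f = composition_operator symbol f"
  proof
    fix z
    show "T f z = composition_operator symbol f z"
      \<comment> \<open>Off the disc both sides are 0, the left one because \<open>T f\<close> lies
        in the space.\<close>
      using T_eq_symbol[OF f, of z] T_in[OF f]
      by (simp add: composition_operator_def bergman_space_def)
  qed
qed

end

theorem theorem3p2:
  fixes \<alpha> :: real
    and T :: "(complex \<Rightarrow> complex) \<Rightarrow> (complex \<Rightarrow> complex)"
  assumes "\<alpha> > -1"
    and "bounded_linear_operator \<alpha> T"
    and "\<exists>f\<in>bergman_space \<alpha>. T f \<noteq> (\<lambda>z. 0)"
  shows "almost_multiplicative \<alpha> T \<longleftrightarrow>
    (\<exists>\<Phi>. \<Phi> holomorphic_on unit_disc \<and> \<Phi> ` unit_disc \<subseteq> unit_disc \<and>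
         (\<forall>f\<in>bergman_space \<alpha>. T f = composition_operator \<Phi> f))"
proof
  assume "almost_multiplicative \<alpha> T"
  with assms interpret almost_multiplicative_operator \<alpha> T
    by unfold_locales
  show "\<exists>\<Phi>. \<Phi> holomorphic_on unit_disc \<and> \<Phi> ` unit_disc \<subseteq> unit_disc \<and>
      (\<forall>f\<in>bergman_space \<alpha>. T f = composition_operator \<Phi> f)"
    by (rule is_composition_operator)
next
  assume "\<exists>\<Phi>. \<Phi> holomorphic_on unit_disc \<and> \<Phi> ` unit_disc \<subseteq> unit_disc \<and>
      (\<forall>f\<in>bergman_space \<alpha>. T f = composition_operator \<Phi> f)"
  \<comment> \<open>Composition commutes with pointwise products; the product lies in the space by
    assumption, so the formula for T applies to it as well.\<close>
  then show "almost_multiplicative \<alpha> T"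
    by (auto simp: almost_multiplicative_def composition_operator_def fun_eq_iff)
qed

end
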